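(* Let $\alpha>0$ be an ordinal and let $n\in\omega$. Let $\mathfrak{C}$ be the full quasi-polyadic equality weak set algebra of dimension $\alpha$ with unit $V=\{s\in{}^{\alpha}\mathbb{Q}: |\{i\in\alpha: s_i\neq 0\}|<\omega\}$. For $k\in\omega$ put $a_k=\{s\in V: \sum_{i<\alpha}s_i=k\}$, and let $\mathfrak{A}_n$ be the subalgebra of $\mathfrak{C}$ generated by $\{a_i: i<2^n\}$. Then $\mathfrak{A}_n$ cannot be generated by $n$ elements (that is, there is no subset $X$ of the universe of $\mathfrak{A}_n$ with $|X|\le n$ that generates $\mathfrak{A}_n$), but $\mathfrak{A}_n$ can be generated by $n+1$ elements.
   Context: $\mathbb{Q}$ is the set of rational numbers and ${}^{\alpha}\mathbb{Q}$ is the set of all functions from $\alpha$ to $\mathbb{Q}$. For $s\in V$ the sum $\sum_{i<\alpha}s_i$ has only finitely many nonzero terms. The full quasi-polyadic equality weak set algebra with unit $V$ is $$\mathfrak{C}=\langle \wp(V),\cup,\cap,\sim,\emptyset,V,\mathsf{c}_i,\mathsf{d}_{ij},\mathsf{s}_{[i,j]}\rangle_{i,j<\alpha},$$ where $\sim$ is complementation relative to $V$, $\wp(V)$ is the power set of $V$, and for $X\subseteq V$: - $\mathsf{c}_iX=\{s\in V: \exists t\in X,\ t(j)=s(j)\text{ for all } j\neq i\}$ (cylindrifications); - $\mathsf{d}_{ij}=\{s\in V: s_i=s_j\}$ (diagonal elements, which are constants); - $\mathsf{s}_{[i,j]}X=\{s\in V: s\circ[i,j]\in X\}$ (substitutions),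 where $[i,j]:\alpha\to\alpha$ is the transposition interchanging $i$ and $j$ and fixing every other element of $\alpha$. "Subalgebra" and "generated" refer to all the operations of $\mathfrak{C}$ listed above, including the constants. *)

theory Defs
  imports Main "HOL.Rat" "HOL.Hull" "HOL-Combinatorics.Transposition"
begin

text \<open>
  An ordinal is represented by a reflexive well-order relation \<open>\<alpha>\<close>, and \<open>i < \<alpha>\<close> by
  \<open>i \<in> Field \<alpha>\<close>; the algebra depends on \<open>\<alpha>\<close> only through the index set \<open>I = Field \<alpha>\<close>.
  A function from \<open>I\<close> to the rationals is an extensional function, i.e. it has the value
  \<^const>\<open>undefined\<close> outside \<open>I\<close>, so that it is determined by its values on \<open>I\<close>.
\<close>

definition weak_unit :: "'i set \<Rightarrow> ('i \<Rightarrow> rat) set" where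
  "weak_unit I = {s. (\<forall>i. i \<notin> I \<longrightarrow> s i = undefined) \<and> finite {i \<in> I. s i \<noteq> 0}}"

definition cyl :: "'i set \<Rightarrow> 'i \<Rightarrow> ('i \<Rightarrow> rat) set \<Rightarrow> ('i \<Rightarrow> rat) set" where
  "cyl I i X = {s \<in> weak_unit I. \<exists>t\<in>X. \<forall>j\<in>I. j \<noteq> i \<longrightarrow> t j = s j}"

definition diag :: "'i set \<Rightarrow> 'i \<Rightarrow> 'i \<Rightarrow> ('i \<Rightarrow> rat) set" where
  "diag I i j = {s \<in> weak_unit I. s i = s j}"

definition subst :: "'i set \<Rightarrow> 'i \<Rightarrow> 'i \<Rightarrow> ('i \<Rightarrow> rat) set \<Rightarrow> ('i \<Rightarrow> rat) set" where
  "subst I i j X = {s \<in> weak_unit I. s \<circ> Transposition.transpose i j \<in> X}"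

definition subuniverse :: "'i set \<Rightarrow> ('i \<Rightarrow> rat) set set \<Rightarrow> bool" where
  "subuniverse I B \<longleftrightarrow>
     B \<subseteq> Pow (weak_unit I) \<and>
     {} \<in> B \<and> weak_unit I \<in> B \<and>
     (\<forall>X\<in>B. \<forall>Y\<in>B. X \<union> Y \<in> B) \<and>
     (\<forall>X\<in>B. \<forall>Y\<in>B. X \<inter> Y \<in> B) \<and>
     (\<forall>X\<in>B. weak_unit I - X \<in> B) \<and>
     (\<forall>i\<in>I. \<forall>X\<in>B. cyl I i X \<in> B) \<and>
     (\<forall>i\<in>I. \<forall>j\<in>I. diag I i j \<in> B) \<and>
     (\<forall>i\<in>I. \<forall>j\<in>I. \<forall>X\<in>B. subst I i j X \<in> B)"

definition generated :: "'i set \<Rightarrow> ('i \<Rightarrow> rat) set set \<Rightarrow> ('i \<Rightarrow> rat) set set" where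
  "generated I G = subuniverse I hull G"

text \<open>The sum over \<open>I\<close> is taken over the support, since \<^const>\<open>sum\<close> is 0 on infinite sets.\<close>

definition sum_level :: "'i set \<Rightarrow> nat \<Rightarrow> ('i \<Rightarrow> rat) set" where
  "sum_level I k = {s \<in> weak_unit I. (\<Sum>i\<in>{i \<in> I. s i \<noteq> 0}. s i) = of_nat k}"

definition level_algebra :: "'i set \<Rightarrow> nat \<Rightarrow> ('i \<Rightarrow> rat) set set" where
  "level_algebra I n = generated I (sum_level I ` {i. i < 2 ^ n})"

end

theory Submission
  imports Defs
begin

text \<open>
  Every set in the algebra is determined by the zero pattern of finitely many affine functionals
  on the unit, and its \<open>i\<close>-th cylindrification by functionals not depending on coordinate \<open>i\<close>.
  On \<open>V\<close> and on each level set \<open>a\<^sub>k\<close> such a set is either generically true or generically false.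
  A functional not depending on coordinate \<open>i\<close> vanishes on \<open>a\<^sub>k\<close> only if it vanishes on \<open>V\<close>, since
  changing \<open>s\<^sub>i\<close> adjusts the sum; so the generic behaviour of a cylindrification is the same on all
  these \<open>2\<^sup>n + 1\<close> sets.  Now \<open>n\<close> elements cannot tell them all apart, and if two of them are not told
  apart by the generators, they are not told apart by anything generated.
  For the upper bound, label the levels by the subsets of an \<open>n\<close>-element set.
\<close>

section \<open>Affine functionals, generic points and level sets\<close>

text \<open>The pair holds coefficients and constant term. The coefficients need not have finite
  support, since the coordinate sum has all of them equal to 1.\<close>

definition affine_eval :: "'i set \<Rightarrow> ('i \<Rightarrow> rat) \<times> rat \<Rightarrow> ('i \<Rightarrow> rat) \<Rightarrow> rat" where
  "affine_eval I f s = (\<Sum>i\<in>{i \<in> I. s i \<noteq> 0}. fst f i * s i) + snd f"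

text \<open>For finite \<open>F\<close> these are the Boolean combinations of zero sets of members
  of \<open>F\<close>. Phrased through zero patterns, complements and intersections keep the same
  \<open>F\<close>.\<close>

definition determines :: "'i set \<Rightarrow> (('i \<Rightarrow> rat) \<times> rat) set \<Rightarrow> ('i \<Rightarrow> rat) set \<Rightarrow> bool" where
  "determines I F X \<longleftrightarrow> X \<subseteq> weak_unit I \<and>
     (\<forall>s\<in>weak_unit I. \<forall>t\<in>weak_unit I.
        (\<forall>f\<in>F. affine_eval I f s = 0 \<longleftrightarrow> affine_eval I f t = 0) \<longrightarrow> (s \<in> X \<longleftrightarrow> t \<in> X))"

definition finitely_determined :: "'i set \<Rightarrow> ('i \<Rightarrow> rat) set \<Rightarrow> bool" where
  "finitely_determined I X \<longleftrightarrow> (\<exists>F. finite F \<and> determines I F X)"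

text \<open>Genericity is relative to \<open>F\<close> because every point lies on some zero set,
  for instance that of a coordinate minus its value at the point.\<close>

definition generic :: "'i set \<Rightarrow> (('i \<Rightarrow> rat) \<times> rat) set \<Rightarrow> ('i \<Rightarrow> rat) set \<Rightarrow> ('i \<Rightarrow> rat) \<Rightarrow> bool" where
  "generic I F A s \<longleftrightarrow> s \<in> A \<and>
     (\<forall>f\<in>F. affine_eval I f s = 0 \<longrightarrow> (\<forall>t\<in>A. affine_eval I f t = 0))"

text \<open>This would hold vacuously if there were no generic points; \<open>generic_exists\<close>
  rules that out for nonempty line-closed \<open>A\<close>.\<close>

definition generically_in :: "'i set \<Rightarrow> ('i \<Rightarrow> rat) set \<Rightarrow> ('i \<Rightarrow> rat) set \<Rightarrow> bool" where
  "generically_in I A X \<longleftrightarrow> (\<exists>F. finite F \<and> (\<forall>s. generic I F A s \<longrightarrow> s \<in> X))"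

definition line_point :: "'i set \<Rightarrow> rat \<Rightarrow> ('i \<Rightarrow> rat) \<Rightarrow> ('i \<Rightarrow> rat) \<Rightarrow> 'i \<Rightarrow> rat" where
  "line_point I x s t = (\<lambda>i. if i \<in> I then (1 - x) * s i + x * t i else undefined)"

text \<open>Over the rationals these are exactly the affine subspaces of the unit, the empty set
  included.\<close>

definition line_closed :: "'i set \<Rightarrow> ('i \<Rightarrow> rat) set \<Rightarrow> bool" where
  "line_closed I A \<longleftrightarrow> A \<subseteq> weak_unit I \<and> (\<forall>s\<in>A. \<forall>t\<in>A. \<forall>x. line_point I x s t \<in> A)"

text \<open>The unit counts as one more level, which gives the pigeonhole argument one set more than
  there are generators.\<close>

definition levels :: "'i set \<Rightarrow> ('i \<Rightarrow> rat) set set" where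
  "levels I = insert (weak_unit I) (range (sum_level I))"

section \<open>Evaluation of affine functionals\<close>

text \<open>Points have different supports; a common finite index set makes their sums
  comparable.\<close>

lemma affine_eval_superset:
  assumes "finite J" "{i \<in> I. s i \<noteq> 0} \<subseteq> J" "J \<subseteq> I"
  shows "affine_eval I f s = (\<Sum>i\<in>J. fst f i * s i) + snd f"
proof -
  have "(\<Sum>i\<in>{i \<in> I. s i \<noteq> 0}. fst f i * s i) = (\<Sum>i\<in>J. fst f i * s i)"
    by (rule sum.mono_neutral_left) (use assms in auto)
  then show ?thesis by (simp add: affine_eval_def)
qed

lemma finite_support: "s \<in> weak_unit I \<Longrightarrow> finite {i \<in> I. s i \<noteq> 0}"
  by (simp add: weak_unit_def)

lemma fun_upd_weak_unit:
  assumes "s \<in> weak_unit I" "i \<in> I"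
  shows "s(i := x) \<in> weak_unit I"
proof -
  have "{j \<in> I. (s(i := x)) j \<noteq> 0} \<subseteq> insert i {j \<in> I. s j \<noteq> 0}" by auto
  then have "finite {j \<in> I. (s(i := x)) j \<noteq> 0}"
    by (rule finite_subset) (use finite_support[OF assms(1)] in simp)
  then show ?thesis using assms by (auto simp: weak_unit_def)
qed

lemma affine_eval_fun_upd:
  assumes "s \<in> weak_unit I" "i \<in> I"
  shows "affine_eval I f (s(i := x)) = affine_eval I f s + fst f i * (x - s i)"
proof -
  let ?J = "insert i {j \<in> I. s j \<noteq> 0}"
  have J: "finite ?J" "?J \<subseteq> I" using assms finite_support[OF assms(1)] by auto
  have 1: "affine_eval I f (s(i := x)) = (\<Sum>j\<in>?J. fst f j * (s(i := x)) j) + snd f"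
    by (rule affine_eval_superset) (use J in \<open>auto split: if_splits\<close>)
  have 2: "affine_eval I f s = (\<Sum>j\<in>?J. fst f j * s j) + snd f"
    by (rule affine_eval_superset) (use J in auto)
  have "(\<Sum>j\<in>?J - {i}. fst f j * (s(i := x)) j) = (\<Sum>j\<in>?J - {i}. fst f j * s j)"
    by (rule sum.cong) auto
  then show ?thesis
    using sum.remove[OF J(1), of i "\<lambda>j. fst f j * (s(i := x)) j"]
      sum.remove[OF J(1), of i "\<lambda>j. fst f j * s j"]
    unfolding 1 2 by (simp add: algebra_simps)
qed

lemma line_point_support:
  "{i \<in> I. line_point I x s t i \<noteq> 0} \<subseteq> {i \<in> I. s i \<noteq> 0} \<union> {i \<in> I. t i \<noteq> 0}"
  by (auto simp: line_point_def)

lemma line_point_weak_unit: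
  assumes "s \<in> weak_unit I" "t \<in> weak_unit I"
  shows "line_point I x s t \<in> weak_unit I"
  using finite_subset[OF line_point_support[of I x s t]] assms
  by (auto simp: weak_unit_def line_point_def)

lemma affine_eval_line_point:
  assumes "s \<in> weak_unit I" "t \<in> weak_unit I"
  shows "affine_eval I f (line_point I x s t) =
    (1 - x) * affine_eval I f s + x * affine_eval I f t"
proof -
  let ?J = "{i \<in> I. s i \<noteq> 0} \<union> {i \<in> I. t i \<noteq> 0}"
  have J: "finite ?J" "?J \<subseteq> I" using assms by (auto simp: weak_unit_def)
  have *: "affine_eval I f u = (\<Sum>j\<in>?J. fst f j * u j) + snd f"
    if "u \<in> {s, t, line_point I x s t}" for u
    by (rule affine_eval_superset) (use J that line_point_support[of I x s t] in auto)
  have "(\<Sum>j\<in>?J. fst f j * line_point I x s t j) =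
      (\<Sum>j\<in>?J. (1 - x) * (fst f j * s j) + x * (fst f j * t j))"
    by (rule sum.cong) (auto simp: line_point_def algebra_simps)
  also have "\<dots> = (1 - x) * (\<Sum>j\<in>?J. fst f j * s j) + x * (\<Sum>j\<in>?J. fst f j * t j)"
    by (simp add: sum.distrib sum_distrib_left)
  finally show ?thesis
    by (simp add: * algebra_simps)
qed

lemma affine_eval_diff:
  assumes "s \<in> weak_unit I"
  shows "affine_eval I (\<lambda>i. fst g i - q * fst f i, snd g - q * snd f) s =
    affine_eval I g s - q * affine_eval I f s"
  by (simp add: affine_eval_def sum_subtractf sum_distrib_left algebra_simps)

lemma transpose_mem_iff: "i \<in> I \<Longrightarrow> j \<in> I \<Longrightarrow> l \<in> I \<longleftrightarrow> transpose i j l \<in> I"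
  by (auto simp: transpose_def)

lemma transpose_support:
  assumes "i \<in> I" "j \<in> I"
  shows "{l \<in> I. (s \<circ> transpose i j) l \<noteq> 0} = transpose i j ` {l \<in> I. s l \<noteq> 0}"
proof (rule set_eqI)
  fix l
  show "l \<in> {l \<in> I. (s \<circ> transpose i j) l \<noteq> 0} \<longleftrightarrow> l \<in> transpose i j ` {l \<in> I. s l \<noteq> 0}"
    using transpose_mem_iff[OF assms] image_iff[of l "transpose i j" "{l \<in> I. s l \<noteq> 0}"]
    by (metis (mono_tags, lifting) comp_apply mem_Collect_eq transpose_involutory)
qed

lemma transpose_weak_unit:
  assumes "s \<in> weak_unit I" "i \<in> I" "j \<in> I"
  shows "s \<circ> transpose i j \<in> weak_unit I"
proof -
  have "finite {l \<in> I. (s \<circ> transpose i j) l \<noteq> 0}"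
    unfolding transpose_support[OF assms(2,3)] by (intro finite_imageI finite_support assms)
  moreover have "(s \<circ> transpose i j) l = undefined" if "l \<notin> I" for l
    using assms that by (auto simp: weak_unit_def transpose_def)
  ultimately show ?thesis by (auto simp: weak_unit_def)
qed

text \<open>A transposition is its own inverse, so reindexing the sum moves it from the point to the
  coefficients.\<close>

lemma affine_eval_transpose:
  assumes "i \<in> I" "j \<in> I"
  shows "affine_eval I f (s \<circ> transpose i j) = affine_eval I (fst f \<circ> transpose i j, snd f) s"
  unfolding affine_eval_def transpose_support[OF assms]
  by (subst sum.reindex) (auto intro: inj_on_subset[OF inj_transpose])

section \<open>Level sets as affine subspaces\<close>

lemma sum_level_iff:
  "s \<in> sum_level I k \<longleftrightarrow> s \<in> weak_unit I \<and> affine_eval I (\<lambda>_. 1, - of_nat k) s = 0"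
  by (auto simp: sum_level_def affine_eval_def)

lemma line_closed_levels:
  assumes "A \<in> levels I" shows "line_closed I A"
  using assms by (auto simp: levels_def line_closed_def sum_level_iff line_point_weak_unit
      affine_eval_line_point)

lemma transpose_levels:
  assumes "A \<in> levels I" "i \<in> I" "j \<in> I" "s \<in> A"
  shows "s \<circ> transpose i j \<in> A"
proof -
  \<comment> \<open>All coefficients of the sum functional are equal, so a transposition leaves it
    unchanged.\<close>
  have "(\<lambda>_. 1 :: rat) \<circ> transpose i j = (\<lambda>_. 1)" by auto
  then show ?thesis
    using assms by (auto simp: levels_def sum_level_iff transpose_weak_unit affine_eval_transpose)
qed

lemma levels_subset: "A \<in> levels I \<Longrightarrow> A \<subseteq> weak_unit I"
  by (auto simp: levels_def sum_level_iff)

text \<open>The sum has coefficient 1 at \<open>i\<close>, so that coordinate alone can absorb any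
  defect.\<close>

lemma levels_adjust:
  assumes "A \<in> levels I" "s \<in> weak_unit I" "i \<in> I"
  shows "\<exists>x. s(i := x) \<in> A"
proof (cases "A = weak_unit I")
  case True
  then show ?thesis using fun_upd_weak_unit[OF assms(2,3)] by auto
next
  case False
  then obtain k where k: "A = sum_level I k" using assms by (auto simp: levels_def)
  have "s(i := s i - affine_eval I (\<lambda>_. 1, - of_nat k) s) \<in> A"
    unfolding k sum_level_iff using fun_upd_weak_unit[OF assms(2,3)]
    by (simp add: affine_eval_fun_upd[OF assms(2,3)])
  then show ?thesis by blast
qed

lemma zero_weak_unit: "(\<lambda>i. if i \<in> I then 0 else undefined) \<in> weak_unit I"
  by (simp add: weak_unit_def)

lemma levels_nonempty:
  assumes "A \<in> levels I" "I \<noteq> {}" shows "A \<noteq> {}"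
  using levels_adjust[OF assms(1) zero_weak_unit] assms(2) by blast

section \<open>Existence of generic points\<close>

lemma finite_affine_roots:
  fixes a b :: rat
  assumes "a \<noteq> 0 \<or> b \<noteq> 0"
  shows "finite {x. (1 - x) * a + x * b = 0}"
proof -
  have "x = a / (a - b)" if "(1 - x) * a + x * b = 0" for x
  proof -
    have "a \<noteq> b" using that assms by (auto simp: algebra_simps)
    then show ?thesis using that by (simp add: field_simps)
  qed
  then have "{x. (1 - x) * a + x * b = 0} \<subseteq> {a / (a - b)}" by blast
  then show ?thesis using finite_subset by blast
qed

lemma avoid_finite: "finite (S :: rat set) \<Longrightarrow> \<exists>x. x \<notin> S"
  using ex_new_if_finite infinite_UNIV_char_0 by blast

text \<open>A rational affine space is not a finite union of proper subspaces. In the induction a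
  point generic for \<open>F\<close> is moved along a line towards a point \<open>t\<close> where
  the new functional does not vanish.\<close>

lemma generic_exists:
  assumes "line_closed I A" "A \<noteq> {}" "finite F"
  shows "\<exists>s. generic I F A s"
  using assms(3)
proof induction
  case empty
  then show ?case using assms by (auto simp: generic_def)
next
  case (insert f F)
  then obtain s where s: "generic I F A s" by blast
  then have sA: "s \<in> A" by (simp add: generic_def)
  show ?case
  proof (cases "\<forall>t\<in>A. affine_eval I f t = 0")
    case True
    then show ?thesis using s by (auto simp: generic_def)
  next
    case False
    then obtain t where t: "t \<in> A" "affine_eval I f t \<noteq> 0" by blast
    let ?bad = "\<lambda>g. {x. (1 - x) * affine_eval I g s + x * affine_eval I g t = 0}"
    \<comment> \<open>A functional vanishing at both \<open>s\<close> and \<open>t\<close> is not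
      \<open>f\<close>, hence belongs to \<open>F\<close> and vanishes on \<open>A\<close> because
      \<open>s\<close> is generic. Each of the others has at most one root on the line.\<close>
    let ?G = "{g \<in> insert f F. affine_eval I g s \<noteq> 0 \<or> affine_eval I g t \<noteq> 0}"
    have "finite (\<Union>g\<in>?G. ?bad g)"
      using insert.hyps by (auto intro!: finite_affine_roots)
    then obtain x where x: "x \<notin> (\<Union>g\<in>?G. ?bad g)" using avoid_finite by blast
    have st: "s \<in> weak_unit I" "t \<in> weak_unit I"
      using assms(1) sA t by (auto simp: line_closed_def)
    have "\<forall>u\<in>A. affine_eval I g u = 0"
      if "g \<in> insert f F" "affine_eval I g (line_point I x s t) = 0" for g
    proof -
      have "x \<in> ?bad g" using that(2) st by (simp add: affine_eval_line_point)
      then have "g \<notin> ?G" using x by blast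
      then show ?thesis using that(1) s t by (auto simp: generic_def)
    qed
    then have "generic I (insert f F) A (line_point I x s t)"
      using assms(1) sA t by (auto simp: generic_def line_closed_def)
    then show ?thesis by blast
  qed
qed

section \<open>Truth at generic points\<close>

lemma genericD:
  "generic I F A s \<Longrightarrow> f \<in> F \<Longrightarrow> affine_eval I f s = 0 \<Longrightarrow> t \<in> A \<Longrightarrow> affine_eval I f t = 0"
  by (simp add: generic_def)

lemma generic_union: "generic I (F \<union> G) A s \<longleftrightarrow> generic I F A s \<and> generic I G A s"
  by (auto simp: generic_def)

text \<open>All points generic for \<open>F\<close> have the same zero pattern, given by the
  functionals that vanish on \<open>A\<close>. So \<open>X\<close> contains all of them or none, and
  one test point decides.\<close>

lemma generically_in_iff:
  assumes A: "line_closed I A" and F: "finite F" "determines I F X" and s: "generic I F A s"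
  shows "generically_in I A X \<longleftrightarrow> s \<in> X"
proof -
  have eq: "t \<in> X \<longleftrightarrow> s \<in> X" if "generic I F A t" for t
  proof -
    have "affine_eval I f s = 0 \<longleftrightarrow> affine_eval I f t = 0" if "f \<in> F" for f
      using that s \<open>generic I F A t\<close> unfolding generic_def by blast
    moreover have "s \<in> weak_unit I" "t \<in> weak_unit I"
      using A s that unfolding generic_def line_closed_def by blast+
    ultimately show ?thesis using F(2) unfolding determines_def by blast
  qed
  show ?thesis
  proof
    assume "generically_in I A X"
    then obtain G where G: "finite G" "\<And>t. generic I G A t \<Longrightarrow> t \<in> X"
      by (auto simp: generically_in_def)
    have "A \<noteq> {}" using s unfolding generic_def by blast
    \<comment> \<open>The witness \<open>G\<close> may have nothing to do with \<open>F\<close>; a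
      point generic for both links them.\<close>
    then obtain t where "generic I (F \<union> G) A t"
      using generic_exists[OF A, of "F \<union> G"] F(1) G(1) by blast
    then show "s \<in> X" using eq G(2) generic_union by blast
  next
    assume "s \<in> X"
    then show "generically_in I A X" using eq F(1) unfolding generically_in_def by blast
  qed
qed

lemma generically_in_int:
  "generically_in I A (X \<inter> Y) \<longleftrightarrow> generically_in I A X \<and> generically_in I A Y"
proof
  assume "generically_in I A X \<and> generically_in I A Y"
  then obtain F G where "finite F" "\<forall>s. generic I F A s \<longrightarrow> s \<in> X"
    "finite G" "\<forall>s. generic I G A s \<longrightarrow> s \<in> Y"
    by (auto simp: generically_in_def)
  then have "finite (F \<union> G)" "\<forall>s. generic I (F \<union> G) A s \<longrightarrow> s \<in> X \<inter> Y"
    by (auto simp: generic_union)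
  then show "generically_in I A (X \<inter> Y)" unfolding generically_in_def by blast
qed (auto simp: generically_in_def)

section \<open>Finitely determined sets and their closure properties\<close>

lemma determinesD:
  assumes "determines I F X" "s \<in> weak_unit I" "t \<in> weak_unit I"
    and "\<And>f. f \<in> F \<Longrightarrow> affine_eval I f s = 0 \<longleftrightarrow> affine_eval I f t = 0"
  shows "s \<in> X \<longleftrightarrow> t \<in> X"
  using assms unfolding determines_def by blast

lemma determines_Diff: "determines I F X \<Longrightarrow> determines I F (weak_unit I - X)"
  unfolding determines_def by blast

lemma determines_mono: "determines I F X \<Longrightarrow> F \<subseteq> G \<Longrightarrow> determines I G X"
  unfolding determines_def by blast

lemma determines_int:
  assumes "determines I F X" "determines I F Y"
  shows "determines I F (X \<inter> Y)"
  using assms unfolding determines_def by blast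

lemma finitely_determined_Diff:
  "finitely_determined I X \<Longrightarrow> finitely_determined I (weak_unit I - X)"
  by (auto simp: finitely_determined_def intro: determines_Diff)

lemma finitely_determined_int:
  assumes "finitely_determined I X" "finitely_determined I Y"
  shows "finitely_determined I (X \<inter> Y)"
proof -
  obtain F G where F: "finite F" "determines I F X" and G: "finite G" "determines I G Y"
    using assms by (auto simp: finitely_determined_def)
  have "determines I (F \<union> G) (X \<inter> Y)"
    by (intro determines_int) (auto intro: determines_mono F(2) G(2))
  then show ?thesis using F G by (auto simp: finitely_determined_def)
qed

lemma finitely_determined_subset: "finitely_determined I X \<Longrightarrow> X \<subseteq> weak_unit I"
  by (auto simp: finitely_determined_def determines_def)

lemma finitely_determined_zero_set:
  "finitely_determined I {s \<in> weak_unit I. affine_eval I f s = 0}"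
  unfolding finitely_determined_def
  by (rule exI[of _ "{f}"]) (auto simp: determines_def)

lemma finitely_determined_sum_level: "finitely_determined I (sum_level I k)"
proof -
  have "sum_level I k = {s \<in> weak_unit I. affine_eval I (\<lambda>_. 1, - of_nat k) s = 0}"
    by (auto simp: sum_level_iff)
  then show ?thesis using finitely_determined_zero_set by metis
qed

lemma finitely_determined_weak_unit: "finitely_determined I (weak_unit I)"
  unfolding finitely_determined_def by (rule exI[of _ "{}"]) (auto simp: determines_def)

text \<open>For \<open>i = j\<close> the nested conditional would give coefficient 1 instead of 0,
  so that case is treated apart.\<close>

lemma diag_eq:
  assumes "i \<in> I" "j \<in> I" "i \<noteq> j"
  shows "diag I i j =
    {s \<in> weak_unit I. affine_eval I (\<lambda>l. if l = i then 1 else if l = j then - 1 else 0, 0) s = 0}"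
proof -
  have "affine_eval I (\<lambda>l. if l = i then 1 else if l = j then - 1 else 0, 0) s = s i - s j"
    if "s \<in> weak_unit I" for s
  proof -
    \<comment> \<open>\<open>i\<close> and \<open>j\<close> are adjoined because \<open>s\<close>
      may vanish there, while the two delta sums need them in the index set.\<close>
    let ?J = "insert i (insert j {l \<in> I. s l \<noteq> 0})"
    have "finite ?J" using finite_support[OF that] by simp
    have "affine_eval I (\<lambda>l. if l = i then 1 else if l = j then - 1 else 0, 0) s =
        (\<Sum>l\<in>?J. (if l = i then 1 else if l = j then - 1 else 0) * s l)"
      by (subst affine_eval_superset[of ?J]) (use assms \<open>finite ?J\<close> in auto)
    also have "\<dots> = (\<Sum>l\<in>?J. (if l = i then s l else 0) - (if l = j then s l else 0))"
      by (rule sum.cong) (use assms in auto)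
    also have "\<dots> = s i - s j"
      unfolding sum_subtractf using \<open>finite ?J\<close> by (simp add: sum.delta)
    finally show ?thesis .
  qed
  then show ?thesis by (auto simp: diag_def)
qed

lemma finitely_determined_diag:
  assumes "i \<in> I" "j \<in> I"
  shows "finitely_determined I (diag I i j)"
proof (cases "i = j")
  case True
  then show ?thesis using finitely_determined_weak_unit by (simp add: diag_def)
next
  case False
  show ?thesis unfolding diag_eq[OF assms False] by (rule finitely_determined_zero_set)
qed

lemma determines_subst:
  assumes "i \<in> I" "j \<in> I" "determines I F X"
  shows "determines I ((\<lambda>f. (fst f \<circ> transpose i j, snd f)) ` F) (subst I i j X)"
  unfolding determines_def
proof (intro conjI ballI impI)
  show "subst I i j X \<subseteq> weak_unit I" by (auto simp: subst_def)
  fix s t assume st: "s \<in> weak_unit I" "t \<in> weak_unit I"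
    and eq: "\<forall>f\<in>(\<lambda>f. (fst f \<circ> transpose i j, snd f)) ` F.
      affine_eval I f s = 0 \<longleftrightarrow> affine_eval I f t = 0"
  have "affine_eval I f (s \<circ> transpose i j) = 0 \<longleftrightarrow> affine_eval I f (t \<circ> transpose i j) = 0"
    if "f \<in> F" for f
    unfolding affine_eval_transpose[OF assms(1,2)] using eq that by blast
  then have "s \<circ> transpose i j \<in> X \<longleftrightarrow> t \<circ> transpose i j \<in> X"
    using assms(3) st[THEN transpose_weak_unit, OF assms(1,2)] unfolding determines_def by blast
  then show "s \<in> subst I i j X \<longleftrightarrow> t \<in> subst I i j X"
    using st by (simp add: subst_def)
qed

lemma finitely_determined_subst:
  assumes "i \<in> I" "j \<in> I" "finitely_determined I X"
  shows "finitely_determined I (subst I i j X)"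
proof -
  obtain F where "finite F" "determines I F X"
    using assms(3) by (auto simp: finitely_determined_def)
  then show ?thesis
    using determines_subst[OF assms(1,2)] finite_imageI unfolding finitely_determined_def by blast
qed

text \<open>Quantifier elimination: a functional of \<open>F\<close> that depends on coordinate \<open>i\<close> and vanishes
  can be solved for that coordinate; if there is none, finitely many values have to be avoided.\<close>

lemma determines_cyl:
  assumes i: "i \<in> I" and F: "finite F" "determines I F X"
  shows "\<exists>G. finite G \<and> determines I G (cyl I i X) \<and> (\<forall>g\<in>G. fst g i = 0)"
proof -
  \<comment> \<open>Subtracting a multiple of \<open>f\<close> from \<open>g\<close> cancels
    coordinate \<open>i\<close> when \<open>f\<close> depends on it; where \<open>f\<close>
    vanishes, the result has the value of \<open>g\<close>.\<close>
  define h :: "('a \<Rightarrow> rat) \<times> rat \<Rightarrow> ('a \<Rightarrow> rat) \<times> rat \<Rightarrow> ('a \<Rightarrow> rat) \<times> rat"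
    where "h f g = (\<lambda>l. fst g l - fst g i / fst f i * fst f l, snd g - fst g i / fst f i * snd f)"
    for f g
  define G where "G = {f \<in> F. fst f i = 0} \<union>
    (\<lambda>(f, g). h f g) ` {(f, g) \<in> F \<times> F. fst f i \<noteq> 0}"
  have "finite {(f, g) \<in> F \<times> F. fst f i \<noteq> 0}"
    by (rule finite_subset[of _ "F \<times> F"]) (use F in auto)
  then have finG: "finite G" using F by (simp add: G_def)
  have Gi: "\<forall>g\<in>G. fst g i = 0" by (auto simp: G_def h_def)
  have h: "affine_eval I (h f g) s = affine_eval I g s - fst g i / fst f i * affine_eval I f s"
    if "s \<in> weak_unit I" for f g s
    unfolding h_def by (rule affine_eval_diff[OF that])
  have fix_i: "affine_eval I g (s(i := x)) = affine_eval I g s"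
    if "g \<in> G" "s \<in> weak_unit I" for g s x
    using Gi that by (simp add: affine_eval_fun_upd i)
  have transfer: "t \<in> cyl I i X"
    if st: "s \<in> weak_unit I" "t \<in> weak_unit I" and s: "s \<in> cyl I i X"
      and eq: "\<forall>g\<in>G. affine_eval I g s = 0 \<longleftrightarrow> affine_eval I g t = 0" for s t
  proof -
    obtain s' where s': "s' \<in> X" "\<forall>j\<in>I. j \<noteq> i \<longrightarrow> s' j = s j"
      using s by (auto simp: cyl_def)
    have s'V: "s' \<in> weak_unit I" using s' F by (auto simp: determines_def)
    have "s' = s(i := s' i)"
    proof
      fix j show "s' j = (s(i := s' i)) j"
        using s' s'V st by (cases "j \<in> I") (auto simp: weak_unit_def)
    qed
    then have s'G: "affine_eval I g s' = affine_eval I g s" if "g \<in> G" for g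
      using fix_i[OF that st(1)] by metis
    \<comment> \<open>It suffices to give \<open>t(i := y)\<close> the zero pattern of
      \<open>s'\<close> on \<open>F\<close>; then it inherits membership in
      \<open>X\<close>.\<close>
    have "\<exists>y. \<forall>g\<in>F. affine_eval I g s' = 0 \<longleftrightarrow> affine_eval I g (t(i := y)) = 0"
    proof (cases "\<exists>f\<in>F. fst f i \<noteq> 0 \<and> affine_eval I f s' = 0")
      case True
      then obtain f where f: "f \<in> F" "fst f i \<noteq> 0" "affine_eval I f s' = 0" by blast
      \<comment> \<open>The value of coordinate \<open>i\<close> at which \<open>f\<close> vanishes.
        Both points then lie on the zero set of \<open>f\<close>, where \<open>g\<close> agrees with
        \<open>h f g\<close>, which ignores coordinate \<open>i\<close>.\<close>
      define y where "y = t i - affine_eval I f t / fst f i"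
      have tV: "t(i := y) \<in> weak_unit I" by (rule fun_upd_weak_unit[OF st(2) i])
      have fy: "affine_eval I f (t(i := y)) = 0"
        unfolding affine_eval_fun_upd[OF st(2) i] y_def using f(2) by simp
      have "affine_eval I g s' = 0 \<longleftrightarrow> affine_eval I g (t(i := y)) = 0" if "g \<in> F" for g
      proof -
        have hG: "h f g \<in> G" using f that by (auto simp: G_def)
        have "affine_eval I g s' = affine_eval I (h f g) s"
          unfolding s'G[OF hG, symmetric] h[OF s'V] f(3) by simp
        moreover have "affine_eval I g (t(i := y)) = affine_eval I (h f g) t"
          unfolding fix_i[OF hG st(2), of y, symmetric] h[OF tV] fy by simp
        ultimately show ?thesis using eq hG by metis
      qed
      then show ?thesis by blast
    next
      case False
      \<comment> \<open>For \<open>fst g i = 0\<close> the division gives 0, so such a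
        \<open>g\<close> only excludes the value \<open>t i\<close>, which does no harm.\<close>
      let ?S = "(\<lambda>g. t i - affine_eval I g t / fst g i) ` F"
      obtain y where y: "y \<notin> ?S" using avoid_finite[of ?S] F by blast
      have "affine_eval I g s' = 0 \<longleftrightarrow> affine_eval I g (t(i := y)) = 0" if "g \<in> F" for g
      proof (cases "fst g i = 0")
        case True
        then have "g \<in> G" using that by (simp add: G_def)
        then show ?thesis using s'G eq fix_i[OF _ st(2)] by metis
      next
        case gi: False
        then have "affine_eval I g s' \<noteq> 0" using False that by blast
        moreover have "affine_eval I g (t(i := y)) \<noteq> 0"
        proof
          assume "affine_eval I g (t(i := y)) = 0"
          then have "y = t i - affine_eval I g t / fst g i"
            unfolding affine_eval_fun_upd[OF st(2) i] using gi by (simp add: field_simps)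
          then show False using y that by blast
        qed
        ultimately show ?thesis by blast
      qed
      then show ?thesis by blast
    qed
    then obtain y where y: "\<forall>g\<in>F. affine_eval I g s' = 0 \<longleftrightarrow> affine_eval I g (t(i := y)) = 0"
      by blast
    have "t(i := y) \<in> weak_unit I" by (rule fun_upd_weak_unit[OF st(2) i])
    then have "t(i := y) \<in> X" using determinesD[OF F(2) s'V] y s'(1) by metis
    then show ?thesis using st(2) unfolding cyl_def by (auto intro!: bexI[of _ "t(i := y)"])
  qed
  have "cyl I i X \<subseteq> weak_unit I" by (auto simp: cyl_def)
  then have "determines I G (cyl I i X)"
    unfolding determines_def
  proof (intro conjI ballI impI)
    fix s t assume "s \<in> weak_unit I" "t \<in> weak_unit I"
      and "\<forall>g\<in>G. affine_eval I g s = 0 \<longleftrightarrow> affine_eval I g t = 0"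
    then show "s \<in> cyl I i X \<longleftrightarrow> t \<in> cyl I i X"
      using transfer[of s t] transfer[of t s] by metis
  qed
  then show ?thesis using finG Gi by blast
qed

lemma finitely_determined_cyl:
  "i \<in> I \<Longrightarrow> finitely_determined I X \<Longrightarrow> finitely_determined I (cyl I i X)"
  unfolding finitely_determined_def using determines_cyl by metis

section \<open>Generic truth under the operations of the algebra\<close>

text \<open>The same \<open>F\<close> determines \<open>X\<close> and its complement, so one generic
  point tests both.\<close>

lemma generically_in_Diff:
  assumes "A \<in> levels I" "I \<noteq> {}" "finitely_determined I X"
  shows "generically_in I A (weak_unit I - X) \<longleftrightarrow> \<not> generically_in I A X"
proof -
  obtain F where F: "finite F" "determines I F X"
    using assms by (auto simp: finitely_determined_def)
  have A: "line_closed I A" using assms line_closed_levels by blast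
  obtain s where s: "generic I F A s"
    using generic_exists[OF A levels_nonempty F(1)] assms by blast
  have "s \<in> weak_unit I" using s levels_subset assms by (auto simp: generic_def)
  then show ?thesis
    using generically_in_iff[OF A F s] generically_in_iff[OF A F(1) determines_Diff[OF F(2)] s]
    by simp
qed

text \<open>A generic point of the unit can be moved into \<open>A\<close> by changing coordinate
  \<open>i\<close>, unnoticed by functionals that ignore \<open>i\<close>. So one test decides both
  sides, and the answer forgets the level.\<close>

lemma generically_in_cyl:
  assumes A: "A \<in> levels I" and i: "i \<in> I" and X: "finitely_determined I X"
  shows "generically_in I A (cyl I i X) \<longleftrightarrow> generically_in I (weak_unit I) (cyl I i X)"
proof -
  obtain G where G: "finite G" "determines I G (cyl I i X)" "\<forall>g\<in>G. fst g i = 0"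
    using determines_cyl[OF i] X unfolding finitely_determined_def by metis
  have V: "weak_unit I \<in> levels I" by (simp add: levels_def)
  have ne: "weak_unit I \<noteq> {}" using zero_weak_unit by blast
  obtain s where s: "generic I G (weak_unit I) s"
    using generic_exists[OF line_closed_levels[OF V] ne G(1)] by blast
  then have sV: "s \<in> weak_unit I" by (simp add: generic_def)
  obtain x where x: "s(i := x) \<in> A" using levels_adjust[OF A sV i] by blast
  have same: "affine_eval I g (s(i := x)) = affine_eval I g s" if "g \<in> G" for g
    using G that sV i by (simp add: affine_eval_fun_upd)
  \<comment> \<open>If \<open>g\<close> vanishes at the moved point it vanishes at \<open>s\<close>,
    hence on the whole unit and in particular on \<open>A\<close>.\<close>
  have gen: "generic I G A (s(i := x))"
    unfolding generic_def
  proof (intro conjI ballI impI)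
    fix g t assume "g \<in> G" "affine_eval I g (s(i := x)) = 0" "t \<in> A"
    then show "affine_eval I g t = 0"
      using s same levels_subset[OF A] unfolding generic_def by (metis subsetD)
  qed (rule x)
  have "s \<in> cyl I i X \<longleftrightarrow> s(i := x) \<in> cyl I i X"
    by (rule determinesD[OF G(2) sV fun_upd_weak_unit[OF sV i]]) (simp only: same)
  then show ?thesis
    using generically_in_iff[OF line_closed_levels[OF V] G(1,2) s]
      generically_in_iff[OF line_closed_levels[OF A] G(1,2) gen] by simp
qed

text \<open>Transpositions preserve \<open>A\<close>, so a point generic for the transposed
  functionals is sent to one generic for \<open>F\<close>.\<close>

lemma generically_in_subst:
  assumes A: "A \<in> levels I" and ij: "i \<in> I" "j \<in> I" and X: "finitely_determined I X"
  shows "generically_in I A (subst I i j X) \<longleftrightarrow> generically_in I A X"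
proof -
  obtain F where F: "finite F" "determines I F X"
    using X by (auto simp: finitely_determined_def)
  let ?F = "(\<lambda>f. (fst f \<circ> transpose i j, snd f)) ` F"
  have lc: "line_closed I A" using A line_closed_levels by blast
  obtain s where s: "generic I ?F A s"
    using generic_exists[OF lc levels_nonempty[OF A]] ij F by blast
  have gen: "generic I F A (s \<circ> transpose i j)"
    unfolding generic_def
  proof (intro conjI ballI impI)
    show "s \<circ> transpose i j \<in> A" using s transpose_levels[OF A ij] by (simp add: generic_def)
    fix f t assume f: "f \<in> F" "affine_eval I f (s \<circ> transpose i j) = 0" and t: "t \<in> A"
    let ?f = "(fst f \<circ> transpose i j, snd f)"
    have "?f \<in> ?F" using f(1) by blast
    moreover have "affine_eval I ?f s = 0" using f(2) unfolding affine_eval_transpose[OF ij] .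
    moreover have "t \<circ> transpose i j \<in> A" using transpose_levels[OF A ij t] .
    ultimately have "affine_eval I ?f (t \<circ> transpose i j) = 0"
      by (rule genericD[OF s])
    moreover have "t \<circ> transpose i j \<circ> transpose i j = t" by (simp add: comp_assoc)
    ultimately show "affine_eval I f t = 0"
      using affine_eval_transpose[OF ij, of f "t \<circ> transpose i j"] by metis
  qed
  have "s \<in> subst I i j X \<longleftrightarrow> s \<circ> transpose i j \<in> X"
    using s levels_subset[OF A] by (auto simp: subst_def generic_def)
  then show ?thesis
    using generically_in_iff[OF lc finite_imageI[OF F(1)] determines_subst[OF ij F(2)] s]
      generically_in_iff[OF lc F gen] by simp
qed

lemma generically_in_superset: "A \<subseteq> X \<Longrightarrow> generically_in I A X"
  unfolding generically_in_def by (rule exI[of _ "{}"]) (auto simp: generic_def)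

lemma generically_in_zero_set_iff:
  assumes A: "A \<in> levels I" "I \<noteq> {}"
  shows "generically_in I A {s \<in> weak_unit I. affine_eval I f s = 0} \<longleftrightarrow>
    (\<forall>s\<in>A. affine_eval I f s = 0)"
proof -
  let ?X = "{s \<in> weak_unit I. affine_eval I f s = 0}"
  have lc: "line_closed I A" using A line_closed_levels by blast
  obtain s where s: "generic I {f} A s"
    using generic_exists[OF lc levels_nonempty[OF A], of "{f}"] by blast
  have "determines I {f} ?X" by (auto simp: determines_def)
  then have "generically_in I A ?X \<longleftrightarrow> s \<in> ?X"
    using generically_in_iff[OF lc _ _ s] by simp
  also have "\<dots> \<longleftrightarrow> (\<forall>s\<in>A. affine_eval I f s = 0)"
    using s levels_subset[OF A(1)] by (auto simp: generic_def)
  finally show ?thesis .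
qed

text \<open>The criterion does not mention \<open>A\<close>: every level has a point whose
  coordinates at distinct \<open>i\<close> and \<open>j\<close> differ.\<close>

lemma generically_in_diag:
  assumes A: "A \<in> levels I" and ij: "i \<in> I" "j \<in> I"
  shows "generically_in I A (diag I i j) \<longleftrightarrow> i = j"
proof (cases "i = j")
  case True
  then show ?thesis using generically_in_superset levels_subset[OF A] by (simp add: diag_def)
next
  case False
  have "\<exists>s\<in>A. s i \<noteq> s j"
  proof -
    let ?z = "\<lambda>l. if l \<in> I then 0 else undefined :: rat"
    \<comment> \<open>On level \<open>k\<close> the value -1 at \<open>j\<close> is compensated by
      \<open>k + 1\<close> at \<open>i\<close>, which is positive and hence different from
      -1.\<close>
    let ?u = "?z(j := - 1)"
    have u: "?u \<in> weak_unit I" by (rule fun_upd_weak_unit[OF zero_weak_unit ij(2)])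
    show ?thesis
    proof (cases "A = weak_unit I")
      case True
      then show ?thesis using u False ij by (intro bexI[of _ ?u]) auto
    next
      case nV: False
      then obtain k where k: "A = sum_level I k" using A by (auto simp: levels_def)
      have z0: "affine_eval I (\<lambda>_. 1, - of_nat k) ?z = - of_nat k"
      proof -
        have "{l \<in> I. ?z l \<noteq> 0} = {}" by auto
        then show ?thesis unfolding affine_eval_def by simp
      qed
      have "affine_eval I (\<lambda>_. 1, - of_nat k) (?u(i := of_nat k + 1)) = 0"
        unfolding affine_eval_fun_upd[OF u ij(1)] affine_eval_fun_upd[OF zero_weak_unit ij(2)] z0
        using False ij by simp
      then have "?u(i := of_nat k + 1) \<in> A"
        unfolding k sum_level_iff by (intro conjI fun_upd_weak_unit[OF u ij(1)])
      moreover have "(of_nat k + 1 :: rat) \<noteq> - 1"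
        using of_nat_0_le_iff[of k, where 'a = rat] by linarith
      ultimately show ?thesis using False by (intro bexI[of _ "?u(i := of_nat k + 1)"]) auto
    qed
  qed
  then have "\<not> A \<subseteq> diag I i j" by (auto simp: diag_def)
  moreover have "I \<noteq> {}" using ij by blast
  ultimately show ?thesis
    using generically_in_zero_set_iff[OF A] levels_subset[OF A] False
    unfolding diag_eq[OF ij False] by auto
qed

lemma sum_level_disjoint: "k \<noteq> l \<Longrightarrow> sum_level I k \<inter> sum_level I l = {}"
  by (auto simp: sum_level_def)

lemma sum_level_neq_weak_unit:
  assumes "I \<noteq> {}"
  shows "sum_level I k \<noteq> weak_unit I"
proof -
  \<comment> \<open>Level \<open>k + 1\<close> supplies points of the unit outside level
    \<open>k\<close>.\<close>
  have "sum_level I (Suc k) \<noteq> {}"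
    using levels_nonempty assms by (auto simp: levels_def)
  moreover have "sum_level I (Suc k) \<subseteq> weak_unit I" by (auto simp: sum_level_def)
  ultimately show ?thesis using sum_level_disjoint[of k "Suc k" I] by auto
qed

text \<open>This is how a level is recognised: being generically in a level amounts to containment,
  and neither the unit nor another level is contained in it.\<close>

lemma generically_in_sum_level:
  assumes A: "A \<in> levels I" "I \<noteq> {}"
  shows "generically_in I A (sum_level I k) \<longleftrightarrow> A = sum_level I k"
proof -
  have "generically_in I A (sum_level I k) \<longleftrightarrow> A \<subseteq> sum_level I k"
  proof -
    have "sum_level I k = {s \<in> weak_unit I. affine_eval I (\<lambda>_. 1, - of_nat k) s = 0}"
      by (auto simp: sum_level_iff)
    then show ?thesis
      using generically_in_zero_set_iff[OF A, of "(\<lambda>_. 1, - of_nat k)"] levels_subset[OF A(1)]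
      by auto
  qed
  also have "\<dots> \<longleftrightarrow> A = sum_level I k"
  proof
    assume sub: "A \<subseteq> sum_level I k"
    have ne: "A \<noteq> {}" using levels_nonempty[OF A] .
    have "A \<noteq> weak_unit I"
      using sub sum_level_neq_weak_unit[OF A(2), of k] by (auto simp: sum_level_def)
    then obtain l where "A = sum_level I l" using A by (auto simp: levels_def)
    then show "A = sum_level I k" using sub ne sum_level_disjoint[of k l I] by (cases "k = l") auto
  qed simp
  finally show ?thesis .
qed

section \<open>Generated subalgebras\<close>

lemma subuniverse_generated:
  assumes "G \<subseteq> Pow (weak_unit I)"
  shows "subuniverse I (generated I G)"
proof -
  \<comment> \<open>The full algebra is one of the sets intersected, which keeps the hull inside the
    power set.\<close>
  have "subuniverse I (Pow (weak_unit I))"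
    by (auto simp: subuniverse_def cyl_def diag_def subst_def)
  then have "generated I G \<subseteq> Pow (weak_unit I)"
    unfolding generated_def by (intro hull_minimal assms)
  moreover have "generated I G = \<Inter>{B. subuniverse I B \<and> G \<subseteq> B}"
    by (simp add: generated_def hull_def)
  ultimately show ?thesis
    unfolding subuniverse_def by auto
qed

lemma generated_minimal: "subuniverse I B \<Longrightarrow> G \<subseteq> B \<Longrightarrow> generated I G \<subseteq> B"
  unfolding generated_def by (rule hull_minimal)

lemma generated_superset: "G \<subseteq> generated I G"
  unfolding generated_def by (rule hull_subset)

lemma sum_level_subset: "sum_level I k \<subseteq> weak_unit I"
  by (auto simp: sum_level_def)

lemma subuniverse_level_algebra: "subuniverse I (level_algebra I n)"
  unfolding level_algebra_def
  by (rule subuniverse_generated) (use sum_level_subset in blast)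

lemma sum_level_in_level_algebra: "k < 2 ^ n \<Longrightarrow> sum_level I k \<in> level_algebra I n"
  unfolding level_algebra_def by (rule subsetD[OF generated_superset]) simp

lemma subuniverseI:
  assumes sub: "\<And>X. X \<in> B \<Longrightarrow> X \<subseteq> weak_unit I" and "weak_unit I \<in> B"
    and int: "\<And>X Y. X \<in> B \<Longrightarrow> Y \<in> B \<Longrightarrow> X \<inter> Y \<in> B"
    and diff: "\<And>X. X \<in> B \<Longrightarrow> weak_unit I - X \<in> B"
    and "\<And>i X. i \<in> I \<Longrightarrow> X \<in> B \<Longrightarrow> cyl I i X \<in> B"
    and "\<And>i j. i \<in> I \<Longrightarrow> j \<in> I \<Longrightarrow> diag I i j \<in> B"
    and "\<And>i j X. i \<in> I \<Longrightarrow> j \<in> I \<Longrightarrow> X \<in> B \<Longrightarrow> subst I i j X \<in> B"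
  shows "subuniverse I B"
proof -
  have "{} \<in> B" using diff[OF assms(2)] by simp
  moreover have "X \<union> Y \<in> B" if "X \<in> B" "Y \<in> B" for X Y
  proof -
    have "X \<union> Y = weak_unit I - ((weak_unit I - X) \<inter> (weak_unit I - Y))"
      using sub that by blast
    then show ?thesis using diff[OF int[OF diff[OF that(1)] diff[OF that(2)]]] by simp
  qed
  ultimately show ?thesis using assms unfolding subuniverse_def by auto
qed

lemma subuniverse_finitely_determined: "subuniverse I {X. finitely_determined I X}"
  by (rule subuniverseI)
    (auto dest: finitely_determined_subset intro: finitely_determined_weak_unit
      finitely_determined_int finitely_determined_Diff finitely_determined_cyl
      finitely_determined_diag finitely_determined_subst)

lemma finitely_determined_level_algebra:
  "X \<in> level_algebra I n \<Longrightarrow> finitely_determined I X"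
  using generated_minimal[OF subuniverse_finitely_determined, of "sum_level I ` {i. i < 2 ^ n}" I]
    finitely_determined_sum_level[of I] unfolding level_algebra_def by auto

section \<open>Lower bound by pigeonhole\<close>

text \<open>For complements, intersections and substitutions the truth value on a level is computed
  from those of the arguments; for cylindrifications and diagonals it is the same on all levels. The
  first conjunct is carried along because some of these rules ask for it.\<close>

lemma subuniverse_generically_eq:
  assumes A: "A \<in> levels I" and B: "B \<in> levels I" and I: "I \<noteq> {}"
  shows "subuniverse I
    {X. finitely_determined I X \<and> (generically_in I A X \<longleftrightarrow> generically_in I B X)}"
proof (rule subuniverseI; (elim CollectE conjE)?; (intro CollectI conjI)?)
  show "generically_in I A (weak_unit I) = generically_in I B (weak_unit I)"
    using generically_in_superset levels_subset A B by metis
qed (use A B I in \<open>auto dest: finitely_determined_subset intro: finitely_determined_weak_unit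
      finitely_determined_int finitely_determined_Diff finitely_determined_cyl
      finitely_determined_diag finitely_determined_subst
      simp: generically_in_int generically_in_Diff generically_in_cyl generically_in_diag
        generically_in_subst\<close>)

lemma level_algebra_generators_lower_bound:
  assumes I: "I \<noteq> {}" and X: "X \<subseteq> level_algebra I n" "finite X"
    and gen: "generated I X = level_algebra I n"
  shows "n < card X"
proof (rule ccontr)
  assume "\<not> n < card X"
  \<comment> \<open>The index \<open>2 ^ n\<close> stands for the unit, so \<open>{..2 ^ n}\<close>
    indexes one set more than there are subsets of an \<open>n\<close>-element set.\<close>
  define A where "A k = (if k < 2 ^ n then sum_level I k else weak_unit I)" for k :: nat
  define code where "code k = {Y \<in> X. generically_in I (A k) Y}" for k
  have A: "A k \<in> levels I" for k by (simp add: A_def levels_def)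
  have "code ` {..2 ^ n} \<subseteq> Pow X" by (auto simp: code_def)
  then have "card (code ` {..2 ^ n}) \<le> 2 ^ card X"
    using X(2) card_mono[of "Pow X"] by (simp add: card_Pow)
  also have "\<dots> \<le> 2 ^ n" using \<open>\<not> n < card X\<close> by simp
  finally have "\<not> inj_on code {..2 ^ n}"
    using card_image[of code "{..2 ^ n :: nat}"] by auto
  \<comment> \<open>With \<open>k < l\<close> the index \<open>k\<close> is below
    \<open>2 ^ n\<close>, so \<open>A k\<close> is itself in the algebra, while \<open>A l\<close>
    may be the unit.\<close>
  then obtain k l where kl: "k \<le> 2 ^ n" "l \<le> 2 ^ n" "code k = code l" "k < l"
    unfolding inj_on_def by (metis atMost_iff linorder_neqE_nat)
  let ?B = "{Y. finitely_determined I Y \<and> (generically_in I (A k) Y \<longleftrightarrow> generically_in I (A l) Y)}"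
  have "Y \<in> ?B" if "Y \<in> X" for Y
  proof -
    have "Y \<in> code k \<longleftrightarrow> Y \<in> code l" using kl(3) by simp
    then show ?thesis
      using that X(1) finitely_determined_level_algebra[of Y I n] by (auto simp: code_def)
  qed
  then have "generated I X \<subseteq> ?B"
    by (intro generated_minimal[OF subuniverse_generically_eq[OF A A I]] subsetI)
  then have "level_algebra I n \<subseteq> ?B" unfolding gen .
  moreover have k: "k < 2 ^ n" "A k = sum_level I k" using kl by (auto simp: A_def)
  ultimately have "generically_in I (A k) (A k) \<longleftrightarrow> generically_in I (A l) (A k)"
    using sum_level_in_level_algebra[OF k(1), of I] by auto
  then have "A l = sum_level I k"
    unfolding k(2) using generically_in_sum_level[OF A I] k(2) by metis
  then show False
    using sum_level_disjoint[of k l I] sum_level_neq_weak_unit[OF I, of k] kl(4)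
      levels_nonempty[OF A I, of l] by (auto simp: A_def split: if_splits)
qed

section \<open>Upper bound by labelling the levels\<close>

lemma subuniverse_finite_UN:
  assumes "subuniverse I B" "finite K" "\<And>k. k \<in> K \<Longrightarrow> f k \<in> B"
  shows "(\<Union>k\<in>K. f k) \<in> B"
  using assms(2,3) by induction (use assms(1) in \<open>auto simp: subuniverse_def\<close>)

text \<open>The factor \<open>b\<close> matters when \<open>K\<close> is empty: the intersection
  alone is then the whole type, which need not belong to \<open>B\<close>.\<close>

lemma subuniverse_finite_INT:
  assumes "subuniverse I B" "finite K" "\<And>k. k \<in> K \<Longrightarrow> f k \<in> B" "b \<in> B"
  shows "b \<inter> (\<Inter>k\<in>K. f k) \<in> B"
  using assms(2,3)
proof induction
  case empty
  then show ?case using assms(4) by simp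
next
  case (insert k K)
  then have "f k \<inter> (b \<inter> (\<Inter>k\<in>K. f k)) \<in> B"
    using assms(1) by (auto simp: subuniverse_def)
  then show ?case by (simp add: ac_simps)
qed

text \<open>The cardinality is only bounded here; that the generators are distinct follows later
  from the lower bound.\<close>

lemma level_algebra_generators_upper_bound:
  "\<exists>X \<subseteq> level_algebra I n. finite X \<and> card X \<le> n + 1 \<and> generated I X = level_algebra I n"
proof -
  have card: "card {..<2 ^ n :: nat} = card (Pow {..<n})" by (simp add: card_Pow)
  then obtain e where e: "bij_betw e {..<2 ^ n :: nat} (Pow {..<n})"
    using finite_same_card_bij[OF _ _ card] by auto
  \<comment> \<open>For \<open>j < n\<close> these are the levels whose label contains
    \<open>j\<close>. The extra index \<open>n\<close> takes all generating levels and so cuts off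
    the points lying on none of them.\<close>
  define K where "K j = (if j < n then {k. k < 2 ^ n \<and> j \<in> e k} else {k. k < 2 ^ n})" for j :: nat
  define b where "b j = (\<Union>k\<in>K j. sum_level I k)" for j
  define X where "X = b ` {..n}"
  have K: "k < 2 ^ n" if "k \<in> K j" for j k using that by (auto simp: K_def split: if_splits)
  have finK: "finite (K j)" for j by (rule finite_subset[of _ "{..<2 ^ n}"]) (use K in auto)
  have bV: "b j \<subseteq> weak_unit I" for j using sum_level_subset by (auto simp: b_def)
  have mem: "s \<in> b j \<longleftrightarrow> l \<in> K j" if "s \<in> sum_level I l" for s j l
  proof -
    have "m = l" if "s \<in> sum_level I m" for m
      using that \<open>s \<in> sum_level I l\<close> sum_level_disjoint[of m l I] by blast
    then show ?thesis using that unfolding b_def by blast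
  qed
  have sub: "X \<subseteq> level_algebra I n"
    unfolding X_def b_def
    by (auto intro!: subuniverse_finite_UN[OF subuniverse_level_algebra finK]
        sum_level_in_level_algebra dest: K)
  have sX: "subuniverse I (generated I X)"
    by (rule subuniverse_generated) (use bV in \<open>auto simp: X_def\<close>)
  have level: "sum_level I k \<in> generated I X" if k: "k < 2 ^ n" for k
  proof -
    \<comment> \<open>Each \<open>c j\<close> fixes whether \<open>j\<close> is in the label, so
      together they leave only the label \<open>e k\<close>.\<close>
    define c where "c j = (if j \<in> e k then b j else weak_unit I - b j)" for j
    have bX: "b j \<in> generated I X" if "j \<le> n" for j
      using generated_superset[of X I] that by (auto simp: X_def)
    then have "c j \<in> generated I X" if "j < n" for j
      using that sX by (auto simp: c_def subuniverse_def)
    then have "b n \<inter> (\<Inter>j<n. c j) \<in> generated I X"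
      by (intro subuniverse_finite_INT[OF sX]) (auto intro: bX)
    also have "b n \<inter> (\<Inter>j<n. c j) = sum_level I k"
    proof (intro equalityI subsetI)
      fix s assume s: "s \<in> b n \<inter> (\<Inter>j<n. c j)"
      then obtain l where l: "l < 2 ^ n" "s \<in> sum_level I l" by (auto simp: b_def K_def)
      have "j \<in> e l \<longleftrightarrow> j \<in> e k" if "j < n" for j
      proof -
        have "s \<in> b j \<longleftrightarrow> j \<in> e l"
          unfolding mem[OF l(2)] using l(1) that by (simp add: K_def)
        moreover have "s \<in> c j" using s that by blast
        ultimately show ?thesis by (auto simp: c_def split: if_splits)
      qed
      moreover have "e l \<subseteq> {..<n}" "e k \<subseteq> {..<n}"
        using e k l(1) by (auto simp: bij_betw_def)
      ultimately have "e l = e k" by blast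
      then have "l = k" using e k l(1) by (auto simp: bij_betw_def inj_on_def)
      then show "s \<in> sum_level I k" using l by simp
    next
      fix s assume s: "s \<in> sum_level I k"
      have "s \<in> b n" unfolding mem[OF s] using k by (simp add: K_def)
      moreover have "s \<in> c j" if "j < n" for j
        using s k that sum_level_subset[of I k] by (auto simp: c_def mem[OF s] K_def)
      ultimately show "s \<in> b n \<inter> (\<Inter>j<n. c j)" by blast
    qed
    finally show ?thesis .
  qed
  have "generated I X = level_algebra I n"
  proof
    show "generated I X \<subseteq> level_algebra I n"
      by (rule generated_minimal[OF subuniverse_level_algebra sub])
    show "level_algebra I n \<subseteq> generated I X"
      unfolding level_algebra_def by (rule generated_minimal[OF sX]) (use level in auto)
  qed
  moreover have "card X \<le> n + 1" using card_image_le[of "{..n}" b] by (simp add: X_def)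
  moreover have "finite X" by (simp add: X_def)
  ultimately show ?thesis using sub by blast
qed

theorem theorem2:
  fixes \<alpha> :: "'i rel" and n :: nat
  assumes "Well_order \<alpha>" and "Field \<alpha> \<noteq> {}"
  shows "(\<nexists>X. X \<subseteq> level_algebra (Field \<alpha>) n \<and> finite X \<and> card X \<le> n \<and>
              generated (Field \<alpha>) X = level_algebra (Field \<alpha>) n) \<and>
         (\<exists>X. X \<subseteq> level_algebra (Field \<alpha>) n \<and> finite X \<and> card X = n + 1 \<and>
              generated (Field \<alpha>) X = level_algebra (Field \<alpha>) n)"
proof -
  have lower: "n < card X"
    if "X \<subseteq> level_algebra (Field \<alpha>) n" "finite X"
      "generated (Field \<alpha>) X = level_algebra (Field \<alpha>) n" for X
    using level_algebra_generators_lower_bound[OF assms(2) that] .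
  obtain X where X: "X \<subseteq> level_algebra (Field \<alpha>) n" "finite X" "card X \<le> n + 1"
      "generated (Field \<alpha>) X = level_algebra (Field \<alpha>) n"
    using level_algebra_generators_upper_bound[of "Field \<alpha>" n] by auto
  \<comment> \<open>The lower bound excludes coincidences among the generators.\<close>
  have "card X = n + 1" using lower[OF X(1,2,4)] X(3) by simp
  then have "\<exists>X. X \<subseteq> level_algebra (Field \<alpha>) n \<and> finite X \<and> card X = n + 1 \<and>
      generated (Field \<alpha>) X = level_algebra (Field \<alpha>) n"
    using X by (intro exI[of _ X] conjI)
  then show ?thesis using lower by (auto simp: not_le[symmetric])
qed

end
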